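(* Let $g$ and $n$ be positive integers. If $A\subseteq\{1,2,\dots,n\}$ is a $B^\ast[g]$ set, then $$|A| < 1.258883\,\sqrt{gn}.$$
   Context: For a finite set $A$ of integers, $A+A$ denotes the multiset $\{a_1+a_2\colon a_1,a_2\in A\}$; the multiplicity of an integer $s$ in $A+A$ is the number of ordered pairs $(a_1,a_2)\in A\times A$ with $a_1+a_2=s$. The set $A$ is called a $B^\ast[g]$ set if no element of the multiset $A+A$ has multiplicity greater than $g$. *)

theory Defs
  imports "HOL-Analysis.Analysis" "HOL-Library.Multiset"
begin

(* mset_set of an infinite set is {#}, so this is meaningful for finite A only. *)
definition sum_multiset :: "int set \<Rightarrow> int multiset" where
  "sum_multiset A = {# a + b. (a, b) \<in># mset_set (A \<times> A) #}"

lemma count_sum_multiset: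
  assumes "finite A"
  shows "count (sum_multiset A) s = card {(a, b). a \<in> A \<and> b \<in> A \<and> a + b = s}"
proof -
  let ?P = "{(a, b). a \<in> A \<and> b \<in> A \<and> a + b = s}"
  have *: "{p \<in> A \<times> A. s = (case p of (a, b) \<Rightarrow> a + b)} = ?P"
    by auto
  have "count (sum_multiset A) s = (\<Sum>p\<in>?P. count (mset_set (A \<times> A)) p)"
    using assms by (simp add: sum_multiset_def count_image_mset' *)
  also have "\<dots> = (\<Sum>p\<in>?P. 1)"
    using assms by (intro sum.cong) auto
  finally show ?thesis by simp
qed

definition B_star_set :: "nat \<Rightarrow> int set \<Rightarrow> bool" where
  "B_star_set g A \<longleftrightarrow> finite A \<and> (\<forall>s \<in># sum_multiset A. count (sum_multiset A) s \<le> g)"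

end

theory Submission
  imports Defs "HOL-Real_Asymp.Real_Asymp"
begin

text \<open>
  Scale \<open>A\<close> to a subset of \<open>[-1/4, 1/4]\<close> and let \<open>f\<close> be its normalised density, so that the
  autoconvolution \<open>f * f\<close> is at most \<open>M = 2gn/|A|\<^sup>2\<close>, and it suffices to show \<open>M > 1.262\<close>. For
  a nonnegative cosine polynomial \<open>K\<close> with coefficients \<open>k\<^sub>j > 0\<close> and period \<open>2/3\<close>, estimate
  \<open>\<integral>\<integral> f(x) f(y) (K(x+y) + K(x-y))\<close> in two ways (Martin--O'Bryant, Matolcsi--Vinuesa).
  From above, the first part is at most \<open>M \<integral> K\<close>; the second is controlled by Cauchy--Schwarz, because
  the autocorrelation of \<open>f\<close> has mean 1 and the same \<open>L\<^sup>2\<close> norm as \<open>f * f\<close>, so its variance is at most \<open>M - 1\<close>.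
  From below, the double integral equals \<open>2 \<Sum> k\<^sub>j (\<integral> f(x) cos(3\<pi>jx))\<^sup>2\<close>, and testing against a cosine polynomial
  that is bounded below on \<open>[-1/4, 1/4]\<close> bounds this quadratic form.

  All integrals are replaced by finite sums over the integers. Replacing each element of \<open>A\<close> by a block of
  \<open>L\<close> consecutive integers preserves \<open>|A|\<^sup>2/(gn)\<close>, so the discretisation error vanishes as \<open>L\<close> tends
  to infinity.
\<close>

section \<open>Representation counts\<close>

definition sum_reps :: "int set \<Rightarrow> int \<Rightarrow> (int \<times> int) set" where
  "sum_reps A s = {(a, b). a \<in> A \<and> b \<in> A \<and> a + b = s}"

definition diff_reps :: "int set \<Rightarrow> int \<Rightarrow> (int \<times> int) set" where
  "diff_reps A d = {(a, b). a \<in> A \<and> b \<in> A \<and> a - b = d}"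

lemma finite_sum_reps [simp]: "finite A \<Longrightarrow> finite (sum_reps A s)"
  by (rule finite_subset[of _ "A \<times> A"]) (auto simp: sum_reps_def)

lemma finite_diff_reps [simp]: "finite A \<Longrightarrow> finite (diff_reps A s)"
  by (rule finite_subset[of _ "A \<times> A"]) (auto simp: diff_reps_def)

lemma card_sum_reps_le:
  assumes "B_star_set g A"
  shows "card (sum_reps A s) \<le> g"
proof -
  \<comment> \<open>The definition constrains only sums that occur; any other \<open>s\<close> has
    count 0.\<close>
  have "count (sum_multiset A) s \<le> g"
    using assms by (cases "s \<in># sum_multiset A") (auto simp: B_star_set_def not_in_iff)
  then show ?thesis
    using assms by (simp add: B_star_set_def count_sum_multiset sum_reps_def)
qed

lemma sum_over_sums:
  fixes F :: "int \<Rightarrow> real"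
  assumes "finite A" "finite S" "\<And>a b. a \<in> A \<Longrightarrow> b \<in> A \<Longrightarrow> a + b \<in> S"
  shows "(\<Sum>a\<in>A. \<Sum>b\<in>A. F (a + b)) = (\<Sum>s\<in>S. real (card (sum_reps A s)) * F s)"
proof -
  have "(\<Sum>a\<in>A. \<Sum>b\<in>A. F (a + b)) = (\<Sum>p\<in>A \<times> A. F (fst p + snd p))"
    by (simp add: sum.cartesian_product case_prod_beta)
  also have "\<dots> = (\<Sum>s\<in>S. \<Sum>p\<in>{p \<in> A \<times> A. fst p + snd p = s}. F (fst p + snd p))"
    using assms by (intro sum.group[symmetric]) auto
  also have "\<dots> = (\<Sum>s\<in>S. \<Sum>p\<in>sum_reps A s. F s)"
    by (intro sum.cong) (auto simp: sum_reps_def)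
  finally show ?thesis by simp
qed

lemma sum_over_diffs:
  fixes F :: "int \<Rightarrow> real"
  assumes "finite A" "finite S" "\<And>a b. a \<in> A \<Longrightarrow> b \<in> A \<Longrightarrow> a - b \<in> S"
  shows "(\<Sum>a\<in>A. \<Sum>b\<in>A. F (a - b)) = (\<Sum>d\<in>S. real (card (diff_reps A d)) * F d)"
proof -
  have "(\<Sum>a\<in>A. \<Sum>b\<in>A. F (a - b)) = (\<Sum>p\<in>A \<times> A. F (fst p - snd p))"
    by (simp add: sum.cartesian_product case_prod_beta)
  also have "\<dots> = (\<Sum>s\<in>S. \<Sum>p\<in>{p \<in> A \<times> A. fst p - snd p = s}. F (fst p - snd p))"
    using assms by (intro sum.group[symmetric]) auto
  also have "\<dots> = (\<Sum>s\<in>S. \<Sum>p\<in>diff_reps A s. F s)"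
    by (intro sum.cong) (auto simp: diff_reps_def)
  finally show ?thesis by simp
qed

text \<open>Both sides count the additive energy, since \<open>a + b = c + d\<close> iff \<open>a - c = d - b\<close>.\<close>

lemma sum_card_diff_reps_eq:
  assumes "finite A"
  shows "(\<Sum>a\<in>A. \<Sum>b\<in>A. card (diff_reps A (a - b))) = (\<Sum>a\<in>A. \<Sum>b\<in>A. card (sum_reps A (a + b)))"
proof -
  have "(\<Sum>a\<in>A. \<Sum>b\<in>A. card (diff_reps A (a - b))) = (\<Sum>p\<in>A \<times> A. card (diff_reps A (fst p - snd p)))"
    by (simp add: sum.cartesian_product case_prod_beta)
  also have "\<dots> = card (Sigma (A \<times> A) (\<lambda>p. diff_reps A (fst p - snd p)))"
    using assms by (subst card_SigmaI) auto
  also have "\<dots> = card (Sigma (A \<times> A) (\<lambda>p. sum_reps A (fst p + snd p)))"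
    by (rule bij_betw_same_card[of "\<lambda>((a, c), (d, b)). ((a, b), (c, d))"],
        rule bij_betw_byWitness[where f' = "\<lambda>((a, b), (c, d)). ((a, c), (d, b))"])
       (auto simp: sum_reps_def diff_reps_def)
  also have "\<dots> = (\<Sum>p\<in>A \<times> A. card (sum_reps A (fst p + snd p)))"
    using assms by (subst card_SigmaI) auto
  also have "\<dots> = (\<Sum>a\<in>A. \<Sum>b\<in>A. card (sum_reps A (a + b)))"
    by (simp add: sum.cartesian_product case_prod_beta)
  finally show ?thesis .
qed

text \<open>The left side is the additive energy; counted through sums, each of the |A|^2 ordered
  pairs contributes at most \<open>g\<close>.\<close>

lemma sum_card_diff_reps_square_le:
  assumes "finite A" "finite S" "\<And>a b. a \<in> A \<Longrightarrow> b \<in> A \<Longrightarrow> a - b \<in> S"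
    and g: "\<And>s. card (sum_reps A s) \<le> g"
  shows "(\<Sum>d\<in>S. (real (card (diff_reps A d)))\<^sup>2) \<le> real g * (real (card A))\<^sup>2"
proof -
  have "(\<Sum>d\<in>S. (real (card (diff_reps A d)))\<^sup>2) = (\<Sum>a\<in>A. \<Sum>b\<in>A. real (card (diff_reps A (a - b))))"
    using assms by (subst sum_over_diffs[of A S]) (auto simp: power2_eq_square)
  also have "\<dots> = (\<Sum>a\<in>A. \<Sum>b\<in>A. real (card (sum_reps A (a + b))))"
    using sum_card_diff_reps_eq[OF assms(1)] by (simp flip: of_nat_sum)
  also have "\<dots> \<le> (\<Sum>a\<in>A. \<Sum>b\<in>A. real g)"
    using g by (intro sum_mono) auto
  finally show ?thesis by (simp add: power2_eq_square mult_ac)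
qed

text \<open>The block of \<open>a\<close> consists of the integers \<open>L * a - i\<close> with 0
  <= \<open>i\<close> < \<open>L\<close>. Given a sum \<open>s\<close> and the first offset
  \<open>i\<close>, division by \<open>L\<close> forces the second offset and the sum of the two
  original elements, leaving at most \<open>g\<close> choices for each of the \<open>L\<close>
  values of \<open>i\<close>.\<close>

lemma blow_up:
  assumes "finite A" "A \<subseteq> {1..int n}" "\<And>s. card (sum_reps A s) \<le> g" "L > 0"
  obtains A' where "A' \<subseteq> {1..int (n * L)}" "card A' = card A * L"
    "\<And>s. card (sum_reps A' s) \<le> g * L"
proof
  define I where "I = {0..<int L}"
  define f where "f = (\<lambda>(a, i). int L * a - i)"
  define A' where "A' = f ` (A \<times> I)"
  \<comment> \<open>Negation turns \<open>L * a - i\<close> into \<open>i + L * (- a)\<close>, so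
    remainder and quotient recover \<open>i\<close> and \<open>a\<close>.\<close>
  have decode: "(- f (a, i)) mod int L = i" "- ((- f (a, i)) div int L) = a" if "i \<in> I" for a i
  proof -
    have *: "- f (a, i) = i + int L * (- a)" by (simp add: f_def)
    show "(- f (a, i)) mod int L = i" "- ((- f (a, i)) div int L) = a"
      unfolding * using that \<open>L > 0\<close> by (simp_all add: I_def del: mult_minus_right)
  qed
  have inj: "inj_on f (A \<times> I)"
    by (rule inj_on_inverseI[of _ "\<lambda>x. (- ((- x) div int L), (- x) mod int L)"])
       (use decode in auto)
  show "card A' = card A * L"
    using inj by (simp add: A'_def card_image card_cartesian_product I_def)
  show "A' \<subseteq> {1..int (n * L)}"
  proof
    fix x assume "x \<in> A'"
    then obtain a i where x: "x = int L * a - i" "a \<in> A" "0 \<le> i" "i < int L"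
      by (auto simp: A'_def f_def I_def)
    have a: "1 \<le> a" "a \<le> int n" using x assms by auto
    have "int L * 1 \<le> int L * a" "int L * a \<le> int L * int n"
      using a by (intro mult_left_mono; simp)+
    moreover have "int (n * L) = int L * int n" by simp
    ultimately have "1 \<le> x" "x \<le> int (n * L)" using x by linarith+
    then show "x \<in> {1..int (n * L)}" by simp
  qed
  show "card (sum_reps A' s) \<le> g * L" for s
  proof -
    define q where "q i = - ((- (s + i)) div int L)" for i
    define R where "R = Sigma I (\<lambda>i. sum_reps A (q i))"
    have finR: "finite R" using assms by (simp add: R_def I_def)
    have "sum_reps A' s \<subseteq> (\<lambda>(i, a, b). (f (a, i), s - f (a, i))) ` R"
    proof
      fix p assume "p \<in> sum_reps A' s"
      then obtain a i b j where p: "p = (f (a, i), f (b, j))" "f (a, i) + f (b, j) = s"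
        and *: "a \<in> A" "b \<in> A" "i \<in> I" "j \<in> I"
        by (auto simp: sum_reps_def A'_def)
      have "- (s + i) = j + int L * (- (a + b))" using p by (simp add: f_def algebra_simps)
      then have "q i = a + b" using * \<open>L > 0\<close> by (simp add: q_def I_def)
      then have "(i, a, b) \<in> R" using * by (simp add: R_def sum_reps_def)
      moreover have "p = (f (a, i), s - f (a, i))" using p by simp
      ultimately show "p \<in> (\<lambda>(i, a, b). (f (a, i), s - f (a, i))) ` R" by force
    qed
    then have "card (sum_reps A' s) \<le> card R"
      using finR by (meson card_image_le card_mono finite_imageI le_trans)
    also have "\<dots> = (\<Sum>i\<in>I. card (sum_reps A (q i)))"
      using assms by (simp add: R_def I_def)
    also have "\<dots> \<le> (\<Sum>i\<in>I. g)" using assms by (intro sum_mono) auto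
    also have "\<dots> = g * L" by (simp add: I_def)
    finally show ?thesis .
  qed
qed

section \<open>The kernel inequality\<close>

definition cos_poly :: "(nat \<Rightarrow> real) \<Rightarrow> nat \<Rightarrow> real \<Rightarrow> real" where
  "cos_poly k N x = (\<Sum>j\<le>N. k j * cos (real j * x))"

lemma cos_poly_add_diff:
  "cos_poly k N (x + y) + cos_poly k N (x - y)
     = 2 * (\<Sum>j\<le>N. k j * (cos (real j * x) * cos (real j * y)))"
proof -
  have "k j * cos (real j * (x + y)) + k j * cos (real j * (x - y))
      = 2 * (k j * (cos (real j * x) * cos (real j * y)))" for j
    by (simp add: distrib_left right_diff_distrib cos_add cos_diff)
  then show ?thesis
    by (simp add: cos_poly_def sum_distrib_left flip: sum.distrib)
qed

text \<open>Adding the kernel at sums to the kernel at differences cancels the products of sines and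
  leaves a diagonal quadratic form in the cosine sums.\<close>

lemma sum_cos_poly_add_diff:
  fixes \<alpha> :: "'a \<Rightarrow> real"
  assumes "finite A"
  shows "(\<Sum>a\<in>A. \<Sum>b\<in>A. cos_poly k N (\<alpha> a + \<alpha> b)) + (\<Sum>a\<in>A. \<Sum>b\<in>A. cos_poly k N (\<alpha> a - \<alpha> b))
    = 2 * (\<Sum>j\<le>N. k j * (\<Sum>a\<in>A. cos (real j * \<alpha> a))\<^sup>2)"
proof -
  have "(\<Sum>a\<in>A. \<Sum>b\<in>A. cos_poly k N (\<alpha> a + \<alpha> b)) + (\<Sum>a\<in>A. \<Sum>b\<in>A. cos_poly k N (\<alpha> a - \<alpha> b))
    = 2 * (\<Sum>a\<in>A. \<Sum>b\<in>A. \<Sum>j\<le>N. k j * (cos (real j * \<alpha> a) * cos (real j * \<alpha> b)))"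
    by (simp add: cos_poly_add_diff sum_distrib_left flip: sum.distrib)
  also have "(\<Sum>a\<in>A. \<Sum>b\<in>A. \<Sum>j\<le>N. k j * (cos (real j * \<alpha> a) * cos (real j * \<alpha> b)))
    = (\<Sum>j\<le>N. \<Sum>a\<in>A. \<Sum>b\<in>A. k j * (cos (real j * \<alpha> a) * cos (real j * \<alpha> b)))"
    by (subst sum.swap[of _ A "{..N}"], subst sum.swap) (rule refl)
  also have "\<dots> = (\<Sum>j\<le>N. k j * (\<Sum>a\<in>A. cos (real j * \<alpha> a))\<^sup>2)"
    by (simp only: power2_eq_square sum_product) (simp add: sum_distrib_left)
  finally show ?thesis .
qed

text \<open>Completing the square, \<open>k C\<^sup>2 \<ge> 2 u C - u\<^sup>2 / k\<close>, makes the quadratic form linear in the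
  cosine sums, so that the pointwise bound \<open>T \<ge> m\<close> applies.\<close>

lemma sum_cos_squares_ge:
  fixes \<alpha> :: "'a \<Rightarrow> real"
  assumes "finite A" and k: "\<And>j. 1 \<le> j \<Longrightarrow> j \<le> N \<Longrightarrow> k j > 0"
    and T: "\<And>a. a \<in> A \<Longrightarrow> m \<le> (\<Sum>j=1..N. t j * cos (real j * \<alpha> a))"
  shows "(real (card A))\<^sup>2 * (k 0 + 2 * m - (\<Sum>j=1..N. (t j)\<^sup>2 / k j))
    \<le> (\<Sum>j\<le>N. k j * (\<Sum>a\<in>A. cos (real j * \<alpha> a))\<^sup>2)"
proof -
  define c where "c = real (card A)"
  define C where "C j = (\<Sum>a\<in>A. cos (real j * \<alpha> a))" for j
  have sq: "2 * c * (t j * C j) - c\<^sup>2 * ((t j)\<^sup>2 / k j) \<le> k j * (C j)\<^sup>2" if "j \<in> {1..N}" for j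
  proof -
    have kj: "k j > 0" using that k by auto
    have "0 \<le> (k j * C j - c * t j)\<^sup>2 / k j" using kj by simp
    also have "\<dots> = k j * (C j)\<^sup>2 - (2 * c * (t j * C j) - c\<^sup>2 * ((t j)\<^sup>2 / k j))"
      using kj by (simp add: field_simps power2_eq_square)
    finally show ?thesis by simp
  qed
  have "c * m \<le> (\<Sum>a\<in>A. \<Sum>j=1..N. t j * cos (real j * \<alpha> a))"
    unfolding c_def using T by (rule sum_bounded_below)
  also have "\<dots> = (\<Sum>j=1..N. t j * C j)"
    unfolding C_def by (subst sum.swap) (simp add: sum_distrib_left)
  finally have "2 * c * (c * m) \<le> 2 * c * (\<Sum>j=1..N. t j * C j)"
    by (intro mult_left_mono) (simp_all add: c_def)
  moreover have "2 * c * (\<Sum>j=1..N. t j * C j) - c\<^sup>2 * (\<Sum>j=1..N. (t j)\<^sup>2 / k j)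
      \<le> (\<Sum>j=1..N. k j * (C j)\<^sup>2)"
  proof -
    have "(\<Sum>j=1..N. 2 * c * (t j * C j) - c\<^sup>2 * ((t j)\<^sup>2 / k j)) \<le> (\<Sum>j=1..N. k j * (C j)\<^sup>2)"
      using sq by (rule sum_mono)
    then show ?thesis by (simp add: sum_subtractf sum_distrib_left)
  qed
  moreover have "(\<Sum>j\<le>N. k j * (C j)\<^sup>2) = k 0 * c\<^sup>2 + (\<Sum>j=1..N. k j * (C j)\<^sup>2)"
    by (simp add: atMost_atLeast0 sum.atLeast_Suc_atMost c_def C_def)
  ultimately show ?thesis
    by (simp add: c_def[symmetric] C_def[symmetric] algebra_simps power2_eq_square)
qed

text \<open>Cauchy--Schwarz for \<open>\<rho> - p\<close> against \<open>K - \<kappa>\<close>, with the AM-GM weight \<open>\<mu>\<close> left free.\<close>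

lemma weighted_sum_le:
  fixes \<rho> K :: "'a \<Rightarrow> real"
  assumes "\<mu> > 0" "p > 0"
  shows "(\<Sum>d\<in>S. \<rho> d * K d) \<le> \<kappa> * (\<Sum>d\<in>S. \<rho> d) + p * (\<Sum>d\<in>S. K d - \<kappa>)
    + \<mu> / (2 * p) * (\<Sum>d\<in>S. (\<rho> d - p)\<^sup>2) + p / (2 * \<mu>) * (\<Sum>d\<in>S. (K d - \<kappa>)\<^sup>2)"
proof -
  have "\<rho> d * K d \<le> \<kappa> * \<rho> d + p * (K d - \<kappa>)
    + \<mu> / (2 * p) * (\<rho> d - p)\<^sup>2 + p / (2 * \<mu>) * (K d - \<kappa>)\<^sup>2" for d
  proof -
    have "0 \<le> (\<mu> * (\<rho> d - p) - p * (K d - \<kappa>))\<^sup>2 / (2 * p * \<mu>)"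
      using assms by simp
    also have "\<dots> = \<mu> / (2 * p) * (\<rho> d - p)\<^sup>2 + p / (2 * \<mu>) * (K d - \<kappa>)\<^sup>2 - (\<rho> d - p) * (K d - \<kappa>)"
      using assms by (simp add: field_simps power2_eq_square)
    finally show ?thesis by (simp add: algebra_simps)
  qed
  then have "(\<Sum>d\<in>S. \<rho> d * K d) \<le> (\<Sum>d\<in>S. \<kappa> * \<rho> d + p * (K d - \<kappa>)
    + \<mu> / (2 * p) * (\<rho> d - p)\<^sup>2 + p / (2 * \<mu>) * (K d - \<kappa>)\<^sup>2)"
    by (rule sum_mono)
  then show ?thesis by (simp add: sum.distrib sum_distrib_left)
qed

text \<open>\<open>D / (2 * real n)\<close> and \<open>E / (2 * real n)\<close> act as the mean of
  the kernel and its mean squared deviation from \<kappa>; \<kappa> and \<mu> stay free for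
  numerical tuning. The term \<open>\<kappa> / (2 * real n)\<close> arises from normalising by 2n
  although there are only 2n - 1 possible differences.\<close>

lemma sumset_kernel_inequality:
  fixes k t :: "nat \<Rightarrow> real" and \<kappa> :: real
  assumes n: "n > 0" and A: "A \<subseteq> {1..int n}" "A \<noteq> {}" and g: "\<And>s. card (sum_reps A s) \<le> g"
    and k: "\<And>j. 1 \<le> j \<Longrightarrow> j \<le> N \<Longrightarrow> k j > 0" and K: "\<And>x. cos_poly k N x \<ge> 0"
    and T: "\<And>x. \<bar>x\<bar> \<le> h * real n / 2 \<Longrightarrow> m \<le> (\<Sum>j=1..N. t j * cos (real j * x))"
    and pos: "\<mu> > 0" "h \<ge> 0"
  defines "D \<equiv> (\<Sum>d\<in>{-int n<..<int n}. cos_poly k N (h * of_int d))"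
    and "E \<equiv> (\<Sum>d\<in>{-int n<..<int n}. (cos_poly k N (h * of_int d) - \<kappa>)\<^sup>2)"
    and "M \<equiv> 2 * real g * real n / (real (card A))\<^sup>2"
  shows "2 * k 0 + 4 * m - 2 * (\<Sum>j=1..N. (t j)\<^sup>2 / k j)
    \<le> (M + 1) * (D / (2 * real n)) + \<kappa> / (2 * real n) + \<mu> / 2 * (M - 1) + E / (2 * real n) / (2 * \<mu>)"
    (is "?B \<le> _")
proof -
  define S where "S = {-int n<..<int n}"
  define c where "c = real (card A)"
  \<comment> \<open>The mean of \<rho> as if the window had 2n points instead of 2n - 1.\<close>
  define p where "p = c\<^sup>2 / (2 * real n)"
  \<comment> \<open>Centring at the midpoint of {1..n} shifts sums into the same window
    \<open>S\<close> as differences, so both parts use the same kernel values.\<close>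
  define \<alpha> where "\<alpha> a = h * (of_int a - (real n + 1) / 2)" for a :: int
  define F where "F d = cos_poly k N (h * of_int d)" for d
  define \<rho> where "\<rho> d = real (card (diff_reps A d))" for d
  have fin: "finite A" using A by (auto intro: finite_subset)
  have c: "c > 0" using fin A by (simp add: c_def card_gt_0_iff)
  have p: "p > 0" using c n by (simp add: p_def)
  have DS: "a - b \<in> S" if "a \<in> A" "b \<in> A" for a b
  proof -
    have "a \<in> {1..int n}" "b \<in> {1..int n}" using that A by auto
    then show ?thesis by (simp add: S_def)
  qed
  have "c\<^sup>2 * ?B \<le> 2 * (\<Sum>j\<le>N. k j * (\<Sum>a\<in>A. cos (real j * \<alpha> a))\<^sup>2)"
  proof -
    have "\<bar>\<alpha> a\<bar> \<le> h * real n / 2" if "a \<in> A" for a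
    proof -
      have "1 \<le> a" "a \<le> int n" using that A by auto
      then have "1 \<le> real_of_int a" "real_of_int a \<le> real n" by linarith+
      then have "\<bar>of_int a - (real n + 1) / 2\<bar> \<le> real n / 2"
        unfolding abs_le_iff by (simp add: field_simps)
      then have "h * \<bar>of_int a - (real n + 1) / 2\<bar> \<le> h * (real n / 2)"
        using pos by (intro mult_left_mono) auto
      then show ?thesis using pos by (simp add: \<alpha>_def abs_mult)
    qed
    then have "c\<^sup>2 * (k 0 + 2 * m - (\<Sum>j=1..N. (t j)\<^sup>2 / k j))
      \<le> (\<Sum>j\<le>N. k j * (\<Sum>a\<in>A. cos (real j * \<alpha> a))\<^sup>2)"
      unfolding c_def by (intro sum_cos_squares_ge fin k T) auto
    then show ?thesis by (simp add: algebra_simps)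
  qed
  also have "\<dots> = (\<Sum>a\<in>A. \<Sum>b\<in>A. cos_poly k N (\<alpha> a + \<alpha> b)) + (\<Sum>a\<in>A. \<Sum>b\<in>A. cos_poly k N (\<alpha> a - \<alpha> b))"
    by (rule sum_cos_poly_add_diff[OF fin, symmetric])
  also have "(\<Sum>a\<in>A. \<Sum>b\<in>A. cos_poly k N (\<alpha> a + \<alpha> b)) = (\<Sum>a\<in>A. \<Sum>b\<in>A. F (a + b - (int n + 1)))"
    by (intro sum.cong refl) (simp add: F_def \<alpha>_def algebra_simps)
  also have "\<dots> = (\<Sum>s\<in>(\<lambda>d. d + (int n + 1)) ` S. real (card (sum_reps A s)) * F (s - (int n + 1)))"
  proof (rule sum_over_sums[OF fin])
    show "a + b \<in> (\<lambda>d. d + (int n + 1)) ` S" if "a \<in> A" "b \<in> A" for a b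
    proof -
      have "a \<in> {1..int n}" "b \<in> {1..int n}" using that A by auto
      then show ?thesis by (intro image_eqI[of _ _ "a + b - (int n + 1)"]) (auto simp: S_def)
    qed
  qed (simp add: S_def)
  also have "\<dots> \<le> (\<Sum>s\<in>(\<lambda>d. d + (int n + 1)) ` S. real g * F (s - (int n + 1)))"
    using g K by (intro sum_mono mult_right_mono) (auto simp: F_def)
  also have "\<dots> = real g * D"
    by (simp add: sum.reindex D_def F_def S_def sum_distrib_left)
  also have "(\<Sum>a\<in>A. \<Sum>b\<in>A. cos_poly k N (\<alpha> a - \<alpha> b)) = (\<Sum>a\<in>A. \<Sum>b\<in>A. F (a - b))"
    by (intro sum.cong refl) (simp add: F_def \<alpha>_def algebra_simps)
  also have "\<dots> = (\<Sum>d\<in>S. \<rho> d * F d)"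
    unfolding \<rho>_def using DS by (intro sum_over_diffs[OF fin]) (auto simp: S_def)
  also have "\<dots> \<le> \<kappa> * (\<Sum>d\<in>S. \<rho> d) + p * (\<Sum>d\<in>S. F d - \<kappa>)
    + \<mu> / (2 * p) * (\<Sum>d\<in>S. (\<rho> d - p)\<^sup>2) + p / (2 * \<mu>) * (\<Sum>d\<in>S. (F d - \<kappa>)\<^sup>2)"
    using pos p by (intro weighted_sum_le) auto
  also have "(\<Sum>d\<in>S. (F d - \<kappa>)\<^sup>2) = E" by (simp add: E_def F_def S_def)
  also have "(\<Sum>d\<in>S. F d - \<kappa>) = D - (2 * real n - 1) * \<kappa>"
    using n by (simp add: D_def F_def S_def sum_subtractf nat_diff_distrib')
  also have \<rho>1: "(\<Sum>d\<in>S. \<rho> d) = c\<^sup>2"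
    using sum_over_diffs[OF fin _ DS, of "\<lambda>_. 1"] by (simp add: S_def \<rho>_def c_def power2_eq_square)
  also have "(\<Sum>d\<in>S. (\<rho> d - p)\<^sup>2) = (\<Sum>d\<in>S. (\<rho> d)\<^sup>2) - 2 * p * c\<^sup>2 + (2 * real n - 1) * p\<^sup>2"
    using n by (simp add: power2_diff sum.distrib sum_subtractf \<rho>1[symmetric] sum_distrib_left
        S_def nat_diff_distrib' mult_ac)
  finally have *: "c\<^sup>2 * ?B \<le> real g * D + (\<kappa> * c\<^sup>2 + p * (D - (2 * real n - 1) * \<kappa>)
    + \<mu> / (2 * p) * ((\<Sum>d\<in>S. (\<rho> d)\<^sup>2) - 2 * p * c\<^sup>2 + (2 * real n - 1) * p\<^sup>2) + p / (2 * \<mu>) * E)"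
    by simp
  have "(\<Sum>d\<in>S. (\<rho> d)\<^sup>2) \<le> real g * c\<^sup>2"
    unfolding \<rho>_def c_def using DS g by (intro sum_card_diff_reps_square_le fin) (auto simp: S_def)
  moreover have "2 * real n * p\<^sup>2 = p * c\<^sup>2" using n by (simp add: p_def power2_eq_square)
  \<comment> \<open>The two multiples of \<open>p * c\<^sup>2\<close> combine to
    \<open>- p * c\<^sup>2\<close>; the leftover \<open>- p\<^sup>2\<close> is discarded.\<close>
  ultimately have "(\<Sum>d\<in>S. (\<rho> d)\<^sup>2) - 2 * p * c\<^sup>2 + (2 * real n - 1) * p\<^sup>2 \<le> real g * c\<^sup>2 - p * c\<^sup>2"
    by (simp add: algebra_simps) (use zero_le_power2[of p] in linarith)
  then have "\<mu> / (2 * p) * ((\<Sum>d\<in>S. (\<rho> d)\<^sup>2) - 2 * p * c\<^sup>2 + (2 * real n - 1) * p\<^sup>2)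
    \<le> \<mu> / (2 * p) * (real g * c\<^sup>2 - p * c\<^sup>2)"
    using pos p by (intro mult_left_mono) auto
  also have "\<dots> = c\<^sup>2 * (\<mu> / 2 * (M - 1))"
    using c n by (simp add: p_def M_def c_def[symmetric] field_simps)
  finally have "c\<^sup>2 * ?B \<le> real g * D + (\<kappa> * c\<^sup>2 + p * (D - (2 * real n - 1) * \<kappa>)
    + c\<^sup>2 * (\<mu> / 2 * (M - 1)) + p / (2 * \<mu>) * E)"
    using * by linarith
  also have "\<dots> = c\<^sup>2 * ((M + 1) * (D / (2 * real n)) + \<kappa> / (2 * real n) + \<mu> / 2 * (M - 1)
    + E / (2 * real n) / (2 * \<mu>))"
    using c n pos by (simp add: p_def M_def c_def[symmetric] field_simps)
  finally show ?thesis
    using c by (simp add: mult_le_cancel_left)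
qed

section \<open>Limits of cosine means\<close>

text \<open>The Dirichlet kernel, kept multiplied by \<open>sin (h / 2)\<close> so that it also
  holds where this factor vanishes.\<close>

lemma sin_half_times_sum_cos:
  "sin (h / 2) * (\<Sum>d\<in>{-int (Suc n)<..<int (Suc n)}. cos (h * of_int d)) = sin (h * (real n + 1 / 2))"
proof (induction n)
  case 0
  have "{-int (Suc 0)<..<int (Suc 0)} = {0}" by auto
  then show ?case by simp
next
  case (Suc n)
  define m where "m = int (Suc n)"
  have "{-int (Suc (Suc n))<..<int (Suc (Suc n))} = insert m (insert (- m) {-m<..<m})"
    by (auto simp: m_def)
  moreover have "m \<noteq> - m" by (simp add: m_def)
  ultimately have "(\<Sum>d\<in>{-int (Suc (Suc n))<..<int (Suc (Suc n))}. cos (h * of_int d))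
    = 2 * cos (h * of_int m) + (\<Sum>d\<in>{-m<..<m}. cos (h * of_int d))"
    by simp
  then have "sin (h / 2) * (\<Sum>d\<in>{-int (Suc (Suc n))<..<int (Suc (Suc n))}. cos (h * of_int d))
    = 2 * sin (h / 2) * cos (h * of_int m) + sin (h * (real n + 1 / 2))"
    using Suc.IH[folded m_def] by (simp only: distrib_left)
  also have "h * (real n + 1 / 2) = h * of_int m - h / 2"
    by (simp add: m_def algebra_simps)
  also have "2 * sin (h / 2) * cos (h * of_int m) + sin (h * of_int m - h / 2) = sin (h * of_int m + h / 2)"
    by (simp add: sin_add sin_diff)
  also have "h * of_int m + h / 2 = h * (real (Suc n) + 1 / 2)"
    by (simp add: m_def algebra_simps)
  finally show ?case .
qed

text \<open>Scaling {1..n} to length 1/2 turns a unit step into 1/(2n), and the basic frequency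
  there is 3 pi. Centred elements then have angles of size at most 3 pi / 4, and differences less
  than 3 pi / 2.\<close>

definition angle_step :: "nat \<Rightarrow> real" where "angle_step n = 3 * pi / (2 * real n)"

definition cos_mean :: "nat \<Rightarrow> real \<Rightarrow> real" where
  "cos_mean n w = (\<Sum>d\<in>{-int n<..<int n}. cos (w * (angle_step n * of_int d))) / (2 * real n)"

text \<open>The mean of cos (w x) over the interval from -3 pi / 2 to 3 pi / 2.\<close>

definition mean_cos :: "real \<Rightarrow> real" where
  "mean_cos w = (if w = 0 then 1 else sin (3 * pi * w / 2) / (3 * pi * w / 2))"

lemma cos_mean_tendsto: "(\<lambda>n. cos_mean n w) \<longlonglongrightarrow> mean_cos w"
proof (cases "w = 0")
  case True
  have "(\<lambda>n. (2 * real n - 1) / (2 * real n)) \<longlonglongrightarrow> 1"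
    by real_asymp
  moreover have "\<forall>\<^sub>F n in sequentially. (2 * real n - 1) / (2 * real n) = cos_mean n w"
    using eventually_gt_at_top[of 0]
    by eventually_elim (simp add: cos_mean_def True nat_diff_distrib')
  ultimately show ?thesis
    using True by (simp add: mean_cos_def tendsto_cong)
next
  case False
  define v where "v = 3 * pi * w"
  have v: "v \<noteq> 0" using False by (simp add: v_def)
  have "(\<lambda>n. v / 4 / real n) \<longlonglongrightarrow> 0" by real_asymp
  then have lim0: "filterlim (\<lambda>n. v / 4 / real n) (at 0) sequentially"
    using v by (auto simp: filterlim_at eventually_sequentially intro!: exI[of _ 1])
  have sinc: "((\<lambda>x::real. sin x / x) \<longlongrightarrow> 1) (at 0)" by real_asymp
  \<comment> \<open>The Dirichlet identity produces the denominator 2n sin(v / (4n)); written as v/2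
    times sin y / y with y = v / (4n), it visibly tends to v/2.\<close>
  from filterlim_compose[OF sinc lim0]
  have 1: "(\<lambda>n. v / 2 * (sin (v / 4 / real n) / (v / 4 / real n))) \<longlonglongrightarrow> v / 2 * 1"
    by (intro tendsto_mult tendsto_const)
  have "(\<lambda>n. sin (v / 2 - v / 4 / real n)) \<longlonglongrightarrow> sin (v / 2 - 0)"
    by (intro tendsto_sin tendsto_diff tendsto_const) real_asymp
  with 1 have "(\<lambda>n. sin (v / 2 - v / 4 / real n) / (v / 2 * (sin (v / 4 / real n) / (v / 4 / real n)))) \<longlonglongrightarrow> sin (v / 2 - 0) / (v / 2 * 1)"
    using v by (intro tendsto_divide) auto
  \<comment> \<open>Since sin x / x tends to 1, sine has no zeros close to 0 other than 0 itself,
    which permits the division for large \<open>n\<close>.\<close>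
  moreover have "\<forall>\<^sub>F x in at (0::real). sin x \<noteq> 0"
    using order_tendstoD(1)[OF sinc zero_less_one] by eventually_elim auto
  then have "\<forall>\<^sub>F n in sequentially. sin (v / 4 / real n) \<noteq> 0"
    using lim0 by (auto simp: filterlim_iff)
  then have "\<forall>\<^sub>F n in sequentially. sin (v / 2 - v / 4 / real n) / (v / 2 * (sin (v / 4 / real n) / (v / 4 / real n))) = cos_mean n w"
    using eventually_gt_at_top[of 0]
  proof eventually_elim
    case (elim n)
    then obtain m where m: "n = Suc m" by (cases n) auto
    define h where "h = w * angle_step n"
    have h: "h / 2 = v / 4 / real n" by (simp add: h_def v_def angle_step_def)
    have "h * (real m + 1 / 2) = v / 2 - v / 4 / real n"
      using elim by (simp add: h_def v_def angle_step_def m field_simps)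
    with sin_half_times_sum_cos[of h m]
    have "sin (v / 4 / real n) * (cos_mean n w * (2 * real n)) = sin (v / 2 - v / 4 / real n)"
      unfolding h using elim by (simp add: cos_mean_def m[symmetric] h_def mult.assoc)
    then show ?case using elim v by (simp add: field_simps)
  qed
  ultimately show ?thesis
    using False by (simp add: mean_cos_def tendsto_cong v_def)
qed

lemma mean_cos_minus [simp]: "mean_cos (- w) = mean_cos w"
  by (simp add: mean_cos_def)

lemma mean_cos_even: "n > 0 \<Longrightarrow> mean_cos (2 * real n) = 0"
  using sin_npi[of "3 * n"] by (simp add: mean_cos_def mult_ac)

text \<open>Together with the vanishing at even frequencies, this makes the moments of a kernel with
  rational coefficients affine in \<open>1 / pi\<close>.\<close>

lemma mean_cos_odd: "mean_cos (2 * real n + 1) = - ((- 1) ^ n) * 2 / (3 * pi * (2 * real n + 1))"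
proof -
  have "3 * pi * (2 * real n + 1) / 2 = real (3 * n + 1) * pi + pi / 2"
    by (simp add: field_simps)
  then have "sin (3 * pi * (2 * real n + 1) / 2) = sin (real (3 * n + 1) * pi + pi / 2)"
    by (rule arg_cong)
  also have "\<dots> = cos (real (3 * n + 1) * pi)"
    unfolding sin_add by simp
  also have "\<dots> = - ((- 1) ^ n)"
    by (subst cos_npi) (simp add: power_add power_mult)
  finally show ?thesis
    by (simp add: mean_cos_def)
qed

lemma cos_poly_mean_tendsto:
  "(\<lambda>n. (\<Sum>d\<in>{-int n<..<int n}. cos_poly k N (angle_step n * of_int d)) / (2 * real n)) \<longlonglongrightarrow> (\<Sum>j\<le>N. k j * mean_cos (real j))"
proof -
  have "(\<Sum>d\<in>{-int n<..<int n}. cos_poly k N (angle_step n * of_int d)) / (2 * real n) = (\<Sum>j\<le>N. k j * cos_mean n (real j))" for n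
    unfolding cos_poly_def cos_mean_def
    by (subst sum.swap) (simp add: sum_distrib_left sum_divide_distrib)
  then show ?thesis
    by (simp add: tendsto_sum tendsto_mult_left cos_mean_tendsto)
qed

lemma cos_poly_square:
  "(cos_poly k N x)\<^sup>2 = (\<Sum>i\<le>N. \<Sum>j\<le>N. k i * k j / 2 * (cos ((real i + real j) * x) + cos ((real i - real j) * x)))"
proof -
  have "k i * cos (real i * x) * (k j * cos (real j * x))
    = k i * k j / 2 * (cos ((real i + real j) * x) + cos ((real i - real j) * x))" for i j
    by (simp add: distrib_right left_diff_distrib cos_add cos_diff)
  then show ?thesis
    unfolding cos_poly_def power2_eq_square sum_product by (intro sum.cong refl)
qed

text \<open>Product-to-sum turns the squared kernel into cosines of frequencies i + j and i - j, so
  the limit again reduces to single cosine means.\<close>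

lemma cos_poly_variance_tendsto:
  "(\<lambda>n. (\<Sum>d\<in>{-int n<..<int n}. (cos_poly k N (angle_step n * of_int d) - \<kappa>)\<^sup>2) / (2 * real n)) \<longlonglongrightarrow>
    (\<Sum>i\<le>N. \<Sum>j\<le>N. k i * k j / 2 * (mean_cos (real i + real j) + mean_cos (real i - real j)))
    - 2 * \<kappa> * (\<Sum>j\<le>N. k j * mean_cos (real j)) + \<kappa>\<^sup>2"
proof -
  let ?D = "\<lambda>n. (\<Sum>d\<in>{-int n<..<int n}. cos_poly k N (angle_step n * of_int d)) / (2 * real n)"
  let ?Q = "\<lambda>n. \<Sum>i\<le>N. \<Sum>j\<le>N. k i * k j / 2 * (cos_mean n (real i + real j) + cos_mean n (real i - real j))"
  have Q: "(\<Sum>d\<in>{-int n<..<int n}. (cos_poly k N (angle_step n * of_int d))\<^sup>2) / (2 * real n) = ?Q n" for n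
  proof -
    have "(\<Sum>d\<in>{-int n<..<int n}. (cos_poly k N (angle_step n * of_int d))\<^sup>2)
      = (\<Sum>i\<le>N. \<Sum>j\<le>N. \<Sum>d\<in>{-int n<..<int n}. k i * k j / 2 *
          (cos ((real i + real j) * (angle_step n * of_int d)) + cos ((real i - real j) * (angle_step n * of_int d))))"
      unfolding cos_poly_square by (subst sum.swap, intro sum.cong refl, rule sum.swap)
    then show ?thesis
      by (simp add: cos_mean_def sum_distrib_left sum_divide_distrib distrib_left sum.distrib add_divide_distrib)
  qed
  have "(\<Sum>d\<in>{-int n<..<int n}. (cos_poly k N (angle_step n * of_int d) - \<kappa>)\<^sup>2) / (2 * real n)
    = ?Q n - 2 * \<kappa> * ?D n + \<kappa>\<^sup>2 * cos_mean n 0" for n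
    unfolding Q[symmetric]
    by (simp add: cos_mean_def power2_diff sum.distrib sum_subtractf sum_distrib_left
        add_divide_distrib diff_divide_distrib mult_ac)
  moreover have "(\<lambda>n. ?Q n - 2 * \<kappa> * ?D n + \<kappa>\<^sup>2 * cos_mean n 0) \<longlonglongrightarrow>
    (\<Sum>i\<le>N. \<Sum>j\<le>N. k i * k j / 2 * (mean_cos (real i + real j) + mean_cos (real i - real j)))
    - 2 * \<kappa> * (\<Sum>j\<le>N. k j * mean_cos (real j)) + \<kappa>\<^sup>2 * mean_cos 0"
    by (intro tendsto_intros cos_mean_tendsto cos_poly_mean_tendsto)
  ultimately show ?thesis by (simp add: mean_cos_def)
qed

section \<open>A kernel of degree ten\<close>

text \<open>The Chebyshev recurrence; it turns the two inequalities below into polynomial identities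
  in \<open>cos x\<close>.\<close>

lemma cos_multiple_angle:
  fixes x :: real
  shows "cos (2 * x) = 2 * cos x ^ 2 - 1"
    and "cos (3 * x) = 4 * cos x ^ 3 - 3 * cos x"
    and "cos (4 * x) = 8 * cos x ^ 4 - 8 * cos x ^ 2 + 1"
    and "cos (5 * x) = 16 * cos x ^ 5 - 20 * cos x ^ 3 + 5 * cos x"
    and "cos (6 * x) = 32 * cos x ^ 6 - 48 * cos x ^ 4 + 18 * cos x ^ 2 - 1"
    and "cos (7 * x) = 64 * cos x ^ 7 - 112 * cos x ^ 5 + 56 * cos x ^ 3 - 7 * cos x"
    and "cos (8 * x) = 128 * cos x ^ 8 - 256 * cos x ^ 6 + 160 * cos x ^ 4 - 32 * cos x ^ 2 + 1"
    and "cos (9 * x) = 256 * cos x ^ 9 - 576 * cos x ^ 7 + 432 * cos x ^ 5 - 120 * cos x ^ 3 + 9 * cos x"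
    and "cos (10 * x) = 512 * cos x ^ 10 - 1280 * cos x ^ 8 + 1120 * cos x ^ 6 - 400 * cos x ^ 4 + 50 * cos x ^ 2 - 1"
proof -
  have step: "cos (y + x) = 2 * cos x * cos y - cos (y - x)" for y
    by (simp add: cos_add cos_diff)
  show c2: "cos (2 * x) = 2 * cos x ^ 2 - 1"
    using step[of x] by (simp add: power2_eq_square)
  have "cos (3 * x) = 2 * cos x * cos (2 * x) - cos x"
    using step[of "2 * x"] by (simp add: algebra_simps)
  then show c3: "cos (3 * x) = 4 * cos x ^ 3 - 3 * cos x"
    unfolding c2 by algebra
  have "cos (4 * x) = 2 * cos x * cos (3 * x) - cos (2 * x)"
    using step[of "3 * x"] by (simp add: algebra_simps)
  then show c4: "cos (4 * x) = 8 * cos x ^ 4 - 8 * cos x ^ 2 + 1"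
    unfolding c3 c2 by algebra
  have "cos (5 * x) = 2 * cos x * cos (4 * x) - cos (3 * x)"
    using step[of "4 * x"] by (simp add: algebra_simps)
  then show c5: "cos (5 * x) = 16 * cos x ^ 5 - 20 * cos x ^ 3 + 5 * cos x"
    unfolding c4 c3 by algebra
  have "cos (6 * x) = 2 * cos x * cos (5 * x) - cos (4 * x)"
    using step[of "5 * x"] by (simp add: algebra_simps)
  then show c6: "cos (6 * x) = 32 * cos x ^ 6 - 48 * cos x ^ 4 + 18 * cos x ^ 2 - 1"
    unfolding c5 c4 by algebra
  have "cos (7 * x) = 2 * cos x * cos (6 * x) - cos (5 * x)"
    using step[of "6 * x"] by (simp add: algebra_simps)
  then show c7: "cos (7 * x) = 64 * cos x ^ 7 - 112 * cos x ^ 5 + 56 * cos x ^ 3 - 7 * cos x"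
    unfolding c6 c5 by algebra
  have "cos (8 * x) = 2 * cos x * cos (7 * x) - cos (6 * x)"
    using step[of "7 * x"] by (simp add: algebra_simps)
  then show c8: "cos (8 * x) = 128 * cos x ^ 8 - 256 * cos x ^ 6 + 160 * cos x ^ 4 - 32 * cos x ^ 2 + 1"
    unfolding c7 c6 by algebra
  have "cos (9 * x) = 2 * cos x * cos (8 * x) - cos (7 * x)"
    using step[of "8 * x"] by (simp add: algebra_simps)
  then show c9: "cos (9 * x) = 256 * cos x ^ 9 - 576 * cos x ^ 7 + 432 * cos x ^ 5 - 120 * cos x ^ 3 + 9 * cos x"
    unfolding c8 c7 by algebra
  have "cos (10 * x) = 2 * cos x * cos (9 * x) - cos (8 * x)"
    using step[of "9 * x"] by (simp add: algebra_simps)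
  then show c10: "cos (10 * x) = 512 * cos x ^ 10 - 1280 * cos x ^ 8 + 1120 * cos x ^ 6 - 400 * cos x ^ 4 + 50 * cos x ^ 2 - 1"
    unfolding c9 c8 by algebra
qed

text \<open>The coefficients come from the factorisations below in powers of \<open>cos x\<close>. The roots there
  are rounded from the numerical optimum of the convex program that maximises the lower bound for \<open>M\<close>
  over all such pairs of cosine polynomials of degree 10; the optimum is about 1.269, which leaves room for rounding.
  The constants \<open>\<kappa>\<close> and \<open>\<mu>\<close> of the final proof are rounded values of the mean of the kernel
  and of the optimal AM-GM weight.\<close>

definition kernel_coeff :: "nat \<Rightarrow> real" where
  "kernel_coeff j = [79782, 123424, 58911, 27476, 30706, 31924, 18689, 8760, 9016, 9120, 3600] ! j"

definition test_coeff :: "nat \<Rightarrow> real" where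
  "test_coeff j = [0, 1077609, -944366, 714387, -452208, 199577, -6142, -95837, 117575, -89400, 31500] ! j / 100"

lemma sum_atMost_10: "(\<Sum>j\<le>10. f j) = f 0 + f 1 + f 2 + f 3 + f 4 + f 5 + f 6 + f 7 + f 8 + f 9 + f 10"
  for f :: "nat \<Rightarrow> real"
  by (simp add: eval_nat_numeral)

lemma sum_1_10: "(\<Sum>j=1..10. f j) = f 1 + f 2 + f 3 + f 4 + f 5 + f 6 + f 7 + f 8 + f 9 + f 10"
  for f :: "nat \<Rightarrow> real"
  by (simp add: eval_nat_numeral)

lemma kernel_coeff_pos: "j \<le> 10 \<Longrightarrow> kernel_coeff j > 0"
proof -
  assume "j \<le> 10"
  then have "kernel_coeff j \<in> set [79782, 123424, 58911, 27476, 30706, 31924, 18689, 8760, 9016, 9120, 3600]"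
    unfolding kernel_coeff_def by (intro nth_mem) simp
  then show ?thesis by auto
qed

lemma kernel_nonneg: "cos_poly kernel_coeff 10 x \<ge> 0"
proof -
  define c where "c = cos x"
  \<comment> \<open>Apart from the constant, every factor is a square except the last, which is a
    square plus a term nonnegative because cos x <= 1.\<close>
  have "cos_poly kernel_coeff 10 x = 32 * (3 * c + 1)\<^sup>2 * (4 * c + 3)\<^sup>2 * (c + 1)\<^sup>2
      * ((20 * c\<^sup>2 - 29 * c + 11)\<^sup>2 + 12 * (1 - c))"
    by (simp add: cos_poly_def sum_atMost_10 kernel_coeff_def cos_multiple_angle c_def[symmetric]) algebra
  also have "\<dots> \<ge> 0"
    by (intro mult_nonneg_nonneg add_nonneg_nonneg) (auto simp: c_def)
  finally show ?thesis .
qed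

lemma test_poly_ge:
  assumes "\<bar>x\<bar> \<le> 3 * pi / 4"
  shows "552695 / 100 \<le> (\<Sum>j=1..10. test_coeff j * cos (real j * x))"
proof -
  define c where "c = cos x"
  \<comment> \<open>The bound is attained at \<open>x = 0\<close>. The simple roots -5/7 and -11/10
    lie below cos (3 pi / 4), so the two linear factors are nonnegative on the allowed
    range.\<close>
  have "100 * (\<Sum>j=1..10. test_coeff j * cos (real j * x)) - 552695 = 64 * (c - 1)\<^sup>2 * (4 * c - 3)\<^sup>2
     * (5 * c - 1)\<^sup>2 * (3 * c + 1)\<^sup>2 * ((7 * c + 5) * (10 * c + 11))"
    unfolding sum_1_10 test_coeff_def by (simp add: cos_multiple_angle c_def[symmetric]) algebra
  also have "\<dots> \<ge> 0"
  proof -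
    have "cos (3 * pi / 4) \<le> cos \<bar>x\<bar>"
      using assms by (intro cos_monotone_0_pi_le) auto
    moreover have "cos (3 * pi / 4) = - (sqrt 2 / 2)"
      using cos_minus_pi[of "pi / 4"] by (simp add: cos_45)
    moreover have "sqrt 2 \<le> 10 / 7"
      by (rule real_le_lsqrt) (auto simp: power2_eq_square)
    ultimately have "7 * c + 5 \<ge> 0" by (simp add: c_def)
    then show ?thesis
      by (intro mult_nonneg_nonneg) auto
  qed
  finally show ?thesis by simp
qed

section \<open>Exact first and second moments of the kernel\<close>

lemma mean_cos_numerals:
  "mean_cos 0 = 1"
  "mean_cos 1 = - (2 / 3) * (1 / pi)"
  "mean_cos 2 = 0"
  "mean_cos 3 = 2 / 9 * (1 / pi)"
  "mean_cos 4 = 0"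
  "mean_cos 5 = - (2 / 15) * (1 / pi)"
  "mean_cos 6 = 0"
  "mean_cos 7 = 2 / 21 * (1 / pi)"
  "mean_cos 8 = 0"
  "mean_cos 9 = - (2 / 27) * (1 / pi)"
  "mean_cos 10 = 0"
  "mean_cos 11 = 2 / 33 * (1 / pi)"
  "mean_cos 12 = 0"
  "mean_cos 13 = - (2 / 39) * (1 / pi)"
  "mean_cos 14 = 0"
  "mean_cos 15 = 2 / 45 * (1 / pi)"
  "mean_cos 16 = 0"
  "mean_cos 17 = - (2 / 51) * (1 / pi)"
  "mean_cos 18 = 0"
  "mean_cos 19 = 2 / 57 * (1 / pi)"
  "mean_cos 20 = 0"
  using mean_cos_odd[of 0] mean_cos_even[of 1] mean_cos_odd[of 1] mean_cos_even[of 2]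
    mean_cos_odd[of 2] mean_cos_even[of 3] mean_cos_odd[of 3] mean_cos_even[of 4]
    mean_cos_odd[of 4] mean_cos_even[of 5] mean_cos_odd[of 5] mean_cos_even[of 6]
    mean_cos_odd[of 6] mean_cos_even[of 7] mean_cos_odd[of 7] mean_cos_even[of 8]
    mean_cos_odd[of 8] mean_cos_even[of 9] mean_cos_odd[of 9] mean_cos_even[of 10]
  by (simp_all add: mean_cos_def[of 0])

lemma kernel_mean: "(\<Sum>j\<le>10. kernel_coeff j * mean_cos (real j)) = 79782 - 25286528 / 315 * (1 / pi)"
proof -
  \<comment> \<open>With \<open>1 / pi\<close> opaque, simplification collects the sum as an affine
    expression in it.\<close>
  define p where "p = 1 / pi"
  show ?thesis
    unfolding p_def[symmetric]
    by (simp add: sum_atMost_10 kernel_coeff_def mean_cos_numerals[folded p_def])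
qed

text \<open>The frequencies i + j reach 20, hence the length of the table of \<open>mean_cos\<close>
  values.\<close>

lemma kernel_second_moment:
  "(\<Sum>i\<le>10. \<Sum>j\<le>10. kernel_coeff i * kernel_coeff j / 2 * (mean_cos (real i + real j) + mean_cos (real i - real j)))
    = 17377347255 - 1983704110604288 / 109395 * (1 / pi)"
proof -
  define p where "p = 1 / pi"
  show ?thesis
    unfolding p_def[symmetric]
    by (simp add: sum_atMost_10 kernel_coeff_def mean_cos_numerals[folded p_def])
qed

section \<open>Passage to the limit of fine blocks and numerical contradiction\<close>

theorem corollary1p3:
  fixes g n :: nat and A :: "int set"
  assumes "g > 0" and "n > 0"
    and "A \<subseteq> {1..int n}"
    and "B_star_set g A"
  shows "real (card A) < 1.258883 * sqrt (real (g * n))"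
proof (rule ccontr)
  define c where "c = real (card A)"
  define M where "M = 2 * real g * real n / c\<^sup>2"
  define \<kappa> where "\<kappa> = (54000 :: real)"
  define \<mu> where "\<mu> = (180000 :: real)"
  define D where "D n = (\<Sum>d\<in>{-int n<..<int n}. cos_poly kernel_coeff 10 (angle_step n * of_int d)) / (2 * real n)" for n
  define E where "E n = (\<Sum>d\<in>{-int n<..<int n}. (cos_poly kernel_coeff 10 (angle_step n * of_int d) - \<kappa>)\<^sup>2) / (2 * real n)" for n
  define B where "B = 2 * kernel_coeff 0 + 4 * (552695 / 100) - 2 * (\<Sum>j=1..10. (test_coeff j)\<^sup>2 / kernel_coeff j)"
  assume "\<not> real (card A) < 1.258883 * sqrt (real (g * n))"
  then have c_ge: "1.258883 * sqrt (real (g * n)) \<le> c" by (simp add: c_def)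
  have gn: "real (g * n) > 0" using assms by simp
  then have "0 < 1.258883 * sqrt (real (g * n))" by (simp del: of_nat_mult)
  then have c: "c > 0" using c_ge by linarith
  have "(1.258883 * sqrt (real (g * n)))\<^sup>2 \<le> c\<^sup>2"
    using c_ge gn by (intro power_mono) auto
  then have "1.258883\<^sup>2 * (real g * real n) \<le> c\<^sup>2"
    unfolding power_mult_distrib using gn by simp
  \<comment> \<open>1.258883 is sqrt (2 / 1.262) rounded up.\<close>
  then have M: "M \<le> 1.262"
    using c gn unfolding M_def by (subst pos_divide_le_eq) (auto simp: power2_eq_square)
  have finA: "finite A" using assms by (simp add: B_star_set_def)
  \<comment> \<open>\<open>M\<close> and \<open>B\<close> are unchanged by the blow-up, so only the
    discretisation terms depend on \<open>L\<close>.\<close>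
  have ineq: "B \<le> (M + 1) * D (n * L) + \<kappa> / (2 * real (n * L)) + \<mu> / 2 * (M - 1) + E (n * L) / (2 * \<mu>)"
    if L: "L > 0" for L
  proof -
    obtain A' where A': "A' \<subseteq> {1..int (n * L)}" "card A' = card A * L"
      "\<And>s. card (sum_reps A' s) \<le> g * L"
      using blow_up[OF finA assms(3) card_sum_reps_le[OF assms(4)] L] by blast
    have M_eq: "M = 2 * real (g * L) * real (n * L) / (real (card A'))\<^sup>2"
      using L by (simp add: A'(2) M_def c_def power2_eq_square)
    have "A' \<noteq> {}" using A'(2) c L by (auto simp: c_def)
    moreover have "angle_step (n * L) * real (n * L) / 2 = 3 * pi / 4"
      using L assms by (simp add: angle_step_def)
    then have "552695 / 100 \<le> (\<Sum>j=1..10. test_coeff j * cos (real j * x))"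
      if "\<bar>x\<bar> \<le> angle_step (n * L) * real (n * L) / 2" for x
      using that by (intro test_poly_ge) (simp only:)
    moreover have "angle_step (n * L) \<ge> 0" "n * L > 0"
      using L assms by (simp_all add: angle_step_def)
    ultimately show ?thesis
      unfolding B_def D_def E_def M_eq
      by (intro sumset_kernel_inequality A' kernel_coeff_pos kernel_nonneg) (simp_all add: \<mu>_def)
  qed
  define K where "K = 79782 - 25286528 / 315 * (1 / pi)"
  define Q where "Q = 17377347255 - 1983704110604288 / 109395 * (1 / pi)"
  have sub: "filterlim (\<lambda>L. n * L) at_top sequentially"
    using assms by (intro filterlim_subseq) (auto simp: strict_mono_def)
  have "D \<longlonglongrightarrow> K"
    unfolding D_def K_def kernel_mean[symmetric] by (rule cos_poly_mean_tendsto)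
  then have limD: "(\<lambda>L. D (n * L)) \<longlonglongrightarrow> K"
    using sub by (rule filterlim_compose)
  have "E \<longlonglongrightarrow> Q - 2 * \<kappa> * K + \<kappa>\<^sup>2"
    unfolding E_def K_def Q_def kernel_mean[symmetric] kernel_second_moment[symmetric]
    by (rule cos_poly_variance_tendsto)
  then have limE: "(\<lambda>L. E (n * L)) \<longlonglongrightarrow> Q - 2 * \<kappa> * K + \<kappa>\<^sup>2"
    using sub by (rule filterlim_compose)
  have "(\<lambda>L. \<kappa> / (2 * real L)) \<longlonglongrightarrow> 0" by real_asymp
  then have lim0: "(\<lambda>L. \<kappa> / (2 * real (n * L))) \<longlonglongrightarrow> 0"
    using sub by (rule filterlim_compose)
  have "B \<le> (M + 1) * K + 0 + \<mu> / 2 * (M - 1) + (Q - 2 * \<kappa> * K + \<kappa>\<^sup>2) / (2 * \<mu>)"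
  proof (rule LIMSEQ_le_const)
    show "(\<lambda>L. (M + 1) * D (n * L) + \<kappa> / (2 * real (n * L)) + \<mu> / 2 * (M - 1) + E (n * L) / (2 * \<mu>))
      \<longlonglongrightarrow> (M + 1) * K + 0 + \<mu> / 2 * (M - 1) + (Q - 2 * \<kappa> * K + \<kappa>\<^sup>2) / (2 * \<mu>)"
      by (intro tendsto_intros limD limE lim0) (simp add: \<mu>_def)
    show "\<exists>N. \<forall>L\<ge>N. B \<le> (M + 1) * D (n * L) + \<kappa> / (2 * real (n * L)) + \<mu> / 2 * (M - 1) + E (n * L) / (2 * \<mu>)"
      using ineq by (intro exI[of _ 1]) auto
  qed
  \<comment> \<open>The coefficient of \<open>M\<close> is nonnegative because
    \<open>K \<ge> 0\<close>, so the worst case is \<open>M = 1.262\<close>.\<close>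
  also have "\<dots> \<le> (1.262 + 1) * K + 0 + \<mu> / 2 * (1.262 - 1) + (Q - 2 * \<kappa> * K + \<kappa>\<^sup>2) / (2 * \<mu>)"
  proof -
    have "K \<ge> 0" using pi_approx by (simp add: K_def field_simps)
    then show ?thesis
      using M by (intro add_mono mult_mono mult_right_mono mult_left_mono) (auto simp: \<mu>_def)
  qed
  finally have "B \<le> (1.262 + 1) * K + \<mu> / 2 * (1.262 - 1) + (Q - 2 * \<kappa> * K + \<kappa>\<^sup>2) / (2 * \<mu>)"
    by simp
  \<comment> \<open>This is pi <= 3.15. As \<open>1 / pi\<close> has a negative coefficient in
    \<open>K\<close> and \<open>Q\<close>, it yields upper bounds for both.\<close>
  moreover have "1 / pi \<ge> 20 / 63"
    using pi_approx by (simp add: field_simps)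
  then have "K \<le> 54298" "Q \<le> 11620709962"
    unfolding K_def Q_def by linarith+
  moreover have "B \<ge> 170718"
    unfolding B_def sum_1_10 by (simp add: kernel_coeff_def test_coeff_def power2_eq_square)
  \<comment> \<open>Collecting terms, \<open>K\<close> has the positive coefficient 2.262 - 0.3, so
    the upper bounds suffice: the right side is below 170493, while \<open>B\<close> is at least
    170718.\<close>
  ultimately show False
    unfolding \<kappa>_def \<mu>_def by (simp add: add_divide_distrib diff_divide_distrib)
qed

end
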